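(* (1) Let $e\ge 4$ be an integer, $q$ a positive integer, $m=e+2q+1$, and let $d$ be a positive integer with $\gcd(m,d)=1$. Then the numerical semigroup $\Gamma_{(e,q,d)}(\mathcal{S})$ generated by $$\mathcal{S}=\{m,\ m+d\}\cup\{(q+1)m+(q+i)d \mid 2\le i\le e-1\}$$ is symmetric. (2) Let $e\ge 4$ be an integer, $q$ a positive even integer with $q\ge e-4$, $m=e+2q$, and let $d$ be an odd positive integer with $\gcd(m,d)=1$. Then the numerical semigroup $\Gamma_{(e,q,d)}(\mathcal{T})$ generated by $$\mathcal{T}=\{m,\ m+d\}\cup\Big\{q(m+1)+\Big(q-\tfrac{e-4}{2}+k\Big)d+\tfrac{e}{2}\ \Big|\ 0\le k\le e-3\Big\}$$ is symmetric.
   Context: A numerical semigroup $\Gamma$ is a subset of the nonnegative integers that contains $0$, is closed under addition and generates $\mathbb{Z}$ as a group. Its Frobenius number $F(\Gamma)$ is the greatest integer not belonging to $\Gamma$. $\Gamma$ is symmetric if $F(\Gamma)$ is odd and $x\in\mathbb{Z}\setminus\Gamma$ implies $F(\Gamma)-x\in\Gamma$. (The elements of $\mathcal{T}$ are integers because $d$ is odd.) *)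

theory Defs
  imports Complex_Main "HOL-Algebra.Elementary_Groups"
begin

text \<open>
  Semigroups are represented as sets of integers, since both the Frobenius number
  and symmetry refer to integers that may be negative.
\<close>

definition numerical_semigroup :: "int set \<Rightarrow> bool" where
  "numerical_semigroup \<Gamma> \<longleftrightarrow>
     \<Gamma> \<subseteq> {0..} \<and> 0 \<in> \<Gamma> \<and> (\<forall>x\<in>\<Gamma>. \<forall>y\<in>\<Gamma>. x + y \<in> \<Gamma>) \<and>
     generate integer_group \<Gamma> = UNIV"

text \<open>
  The complement is taken in the integers, so it contains all negative ones; for a
  numerical semigroup it is bounded above, and hence the greatest element exists.
\<close>

definition frobenius_number :: "int set \<Rightarrow> int" where
  "frobenius_number \<Gamma> = (GREATEST x. x \<notin> \<Gamma>)"

definition symmetric_semigroup :: "int set \<Rightarrow> bool" where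
  "symmetric_semigroup \<Gamma> \<longleftrightarrow>
     odd (frobenius_number \<Gamma>) \<and> (\<forall>x. x \<notin> \<Gamma> \<longrightarrow> frobenius_number \<Gamma> - x \<in> \<Gamma>)"

inductive_set semigroup_generated :: "int set \<Rightarrow> int set" for A :: "int set" where
  zero: "0 \<in> semigroup_generated A"
| incl: "a \<in> A \<Longrightarrow> a \<in> semigroup_generated A"
| add: "x \<in> semigroup_generated A \<Longrightarrow> y \<in> semigroup_generated A \<Longrightarrow>
    x + y \<in> semigroup_generated A"

definition gens_S :: "int \<Rightarrow> int \<Rightarrow> int \<Rightarrow> int set" where
  "gens_S e q d = (let m = e + 2 * q + 1 in
     {m, m + d} \<union> {(q + 1) * m + (q + i) * d | i. 2 \<le> i \<and> i \<le> e - 1})"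

text \<open>
  The halves are genuine rational divisions, also for odd \<open>e\<close>. For odd \<open>d\<close> each of
  the resulting rationals is an integer, so that the comprehension over integers
  loses none of them; see \<open>gens_T_integral\<close> below.
\<close>

definition gens_T :: "int \<Rightarrow> int \<Rightarrow> int \<Rightarrow> int set" where
  "gens_T e q d = (let m = e + 2 * q in
     {m, m + d} \<union>
     {x. \<exists>k. 0 \<le> k \<and> k \<le> e - 3 \<and>
        rat_of_int x =
          of_int (q * (m + 1)) + (of_int q - of_int (e - 4) / 2 + of_int k) * of_int d
          + of_int e / 2})"

lemma gens_T_integral:
  assumes "odd d"
  shows "of_int (q * (m + 1)) + (of_int q - of_int (e - 4) / 2 + of_int k) * of_int d
     + of_int e / 2 \<in> (\<int> :: rat set)"
proof -
  from assms obtain c where c: "d = 2 * c + 1" by (auto elim: oddE)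
  have "of_int (q * (m + 1)) + (of_int q - of_int (e - 4) / 2 + of_int k) * of_int d
      + of_int e / 2
    = rat_of_int (q * (m + 1) + (q + 2 + k) * d - e * c)"
    by (simp add: c field_simps)
  then show ?thesis by (metis Ints_of_int)
qed

end

theory Submission
  imports Defs
begin

text \<open>
  Since \<open>m\<close> and \<open>d\<close> are coprime, every integer is \<open>j d + s m\<close> for a unique \<open>j\<close> with
  \<open>0 \<le> j < m\<close>, and the semigroup is described by the least admissible \<open>s\<close>, written
  \<open>c j\<close>; the numbers \<open>j d + c j m\<close> form its Apery set with respect to \<open>m\<close>.
  For both families \<open>c\<close> is piecewise linear, with slopes 0 and 1. Symmetry amounts to an
  involution of the Apery set whose pairs have constant sum \<open>W\<close>, and then the
  Frobenius number is \<open>W - m\<close>. It is odd because a semigroup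
  containing exactly one of \<open>x\<close> and \<open>F - x\<close> excludes \<open>F = 2 x\<close>.
\<close>

section \<open>Symmetry from a reflection of the integers\<close>

text \<open>The reflection at \<open>F\<close> alone identifies \<open>F\<close> as the Frobenius
  number: for \<open>x > F\<close> the integer \<open>F - x\<close> is negative, so \<open>x\<close>
  cannot be a gap.\<close>

lemma symmetric_numerical_semigroupI:
  fixes G :: "int set" and F :: int
  assumes nonneg: "G \<subseteq> {0..}" and zero: "0 \<in> G"
    and add: "\<And>x y. x \<in> G \<Longrightarrow> y \<in> G \<Longrightarrow> x + y \<in> G"
    and F: "F \<notin> G" and sym: "\<And>x. x \<notin> G \<Longrightarrow> F - x \<in> G"
  shows "numerical_semigroup G" and "symmetric_semigroup G"
proof -
  have large: "x \<in> G" if "x > F" for x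
    using sym[of x] nonneg that by force
  have frob: "frobenius_number G = F"
    unfolding frobenius_number_def
    by (rule Greatest_equality) (use F large in force)+
  have "odd F"
    using F sym add by (metis add_diff_cancel_left' evenE mult_2)
  then show "symmetric_semigroup G"
    using sym by (simp add: symmetric_semigroup_def frob)
  have "x \<in> generate integer_group G" for x
  proof -
    \<comment> \<open>Any \<open>x\<close> is the difference of \<open>x + y\<close> and
      \<open>y\<close>, and this choice puts both beyond \<open>F\<close>.\<close>
    define y where "y = \<bar>F\<bar> + \<bar>x\<bar> + 1"
    have "x + y \<in> G" "y \<in> G"
      by (rule large; simp add: y_def)+
    then have "x + y \<in> generate integer_group G" "- y \<in> generate integer_group G"
      using generate.incl[of "x + y" G integer_group] generate.inv[of y G integer_group]
      by simp_all
    then show ?thesis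
      using generate.eng[of "x + y" integer_group G "- y"] by simp
  qed
  then show "numerical_semigroup G"
    using nonneg zero add by (auto simp: numerical_semigroup_def)
qed

section \<open>Generated semigroups and coordinates with respect to \<open>d\<close> and
  \<open>m\<close>\<close>

lemma semigroup_generated_nonneg:
  assumes "\<And>a. a \<in> A \<Longrightarrow> 0 \<le> a" and "x \<in> semigroup_generated A"
  shows "0 \<le> x"
  using assms(2) by induction (auto simp: assms(1))

lemma semigroup_generated_mult:
  assumes "x \<in> semigroup_generated A" and "0 \<le> n"
  shows "n * x \<in> semigroup_generated A"
  using assms(2)
proof (induction n rule: int_ge_induct)
  case base
  then show ?case by (simp add: semigroup_generated.zero)
next
  case (step n)
  then show ?case
    using semigroup_generated.add[OF step.IH assms(1)] by (simp add: algebra_simps)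
qed

text \<open>Scale a Bezout identity by \<open>x\<close> and reduce the coefficient of
  \<open>d\<close> modulo \<open>m\<close>; the removed multiple of \<open>m * d\<close> is absorbed
  into the coefficient of \<open>m\<close>.\<close>

lemma coprime_representation:
  fixes m d x :: int
  assumes "m > 0" and "gcd m d = 1"
  obtains j s where "0 \<le> j" "j < m" "x = j * d + s * m"
proof -
  obtain u v where uv: "u * m + v * d = 1"
    using bezout_int[of m d] assms(2) by auto
  have "x = x * (u * m + v * d)"
    by (simp add: uv)
  also have "\<dots> = (m * (x * v div m) + x * v mod m) * d + x * u * m"
    by (simp add: algebra_simps)
  also have "\<dots> = (x * v mod m) * d + (x * u + (x * v div m) * d) * m"
    by (simp only: algebra_simps)
  finally show ?thesis
    using that[of "x * v mod m"] assms(1) by simp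
qed

lemma coprime_representation_unique:
  fixes m d :: int
  assumes "gcd m d = 1" and "0 \<le> i" "i < m" "0 \<le> j" "j < m"
    and eq: "i * d + s * m = j * d + t * m"
  shows "i = j" and "s = t"
proof -
  have "(i - j) * d = m * (t - s)"
    using eq by (simp add: algebra_simps)
  then have "m dvd i - j"
    using assms(1) by (metis coprime_dvd_mult_left_iff coprime_iff_gcd_eq_1 dvd_triv_left)
  then show "i = j"
    using assms(2-5) by (metis mod_eq_dvd_iff mod_pos_pos_trivial)
  then show "s = t"
    using eq assms(2,3) by simp
qed

section \<open>Symmetry from a candidate Apery set\<close>

text \<open>The subadditivity assumptions make the set of all \<open>j * d + s * m\<close> with
  \<open>c j \<le> s\<close> closed under addition. It contains the generators by
  \<open>gens\<close>, so it contains \<open>G\<close>; \<open>apery\<close> and \<open>mA\<close>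
  give the reverse inclusion.\<close>

lemma symmetric_of_apery:
  fixes A :: "int set" and c :: "int \<Rightarrow> int" and m d W :: int
  defines "G \<equiv> semigroup_generated A"
  assumes m: "m > 0" and cop: "gcd m d = 1" and mA: "m \<in> A"
    and nonneg: "\<And>a. a \<in> A \<Longrightarrow> 0 \<le> a"
    and c0: "c 0 = 0"
    and sub: "\<And>i j. \<lbrakk>0 \<le> i; i < m; 0 \<le> j; j < m; i + j < m\<rbrakk> \<Longrightarrow> c (i + j) \<le> c i + c j"
    and sub_wrap: "\<And>i j. \<lbrakk>0 \<le> i; i < m; 0 \<le> j; j < m; m \<le> i + j\<rbrakk> \<Longrightarrow>
      c (i + j - m) \<le> c i + c j + d"
    and gens: "\<And>a. a \<in> A \<Longrightarrow> \<exists>j s. 0 \<le> j \<and> j < m \<and> c j \<le> s \<and> a = j * d + s * m"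
    and apery: "\<And>j. \<lbrakk>0 \<le> j; j < m\<rbrakk> \<Longrightarrow> j * d + c j * m \<in> G"
    and sym: "\<And>j. \<lbrakk>0 \<le> j; j < m\<rbrakk> \<Longrightarrow>
      \<exists>k. 0 \<le> k \<and> k < m \<and> (j * d + c j * m) + (k * d + c k * m) = W"
  shows "numerical_semigroup G \<and> symmetric_semigroup G"
proof -
  have above: "j * d + s * m \<in> G" if "0 \<le> j" "j < m" "c j \<le> s" for j s
  proof -
    have "(s - c j) * m \<in> G"
      using that unfolding G_def
      by (intro semigroup_generated_mult semigroup_generated.incl mA) simp
    then have "(j * d + c j * m) + (s - c j) * m \<in> G"
      using semigroup_generated.add apery[OF that(1,2)] unfolding G_def by blast
    then show ?thesis by (simp add: algebra_simps)
  qed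
  have form: "\<exists>j s. 0 \<le> j \<and> j < m \<and> c j \<le> s \<and> x = j * d + s * m" if "x \<in> G" for x
    using that unfolding G_def
  proof induction
    case zero
    then show ?case using m c0 by (intro exI[of _ 0]) auto
  next
    case (incl a)
    then show ?case by (rule gens)
  next
    case (add x y)
    then obtain i s j t where i: "0 \<le> i" "i < m" "c i \<le> s" "x = i * d + s * m"
      and j: "0 \<le> j" "j < m" "c j \<le> t" "y = j * d + t * m" by blast
    show ?case
    proof (cases "i + j < m")
      case True
      then show ?thesis
        using i j sub[of i j]
        by (intro exI[of _ "i + j"] exI[of _ "s + t"]) (auto simp: algebra_simps)
    next
      case False
      then show ?thesis
        using i j sub_wrap[of i j]
        \<comment> \<open>Lowering the index by \<open>m\<close> removes \<open>m * d\<close>, which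
          returns as \<open>d\<close> further copies of \<open>m\<close>.\<close>
        by (intro exI[of _ "i + j - m"] exI[of _ "s + t + d"]) (auto simp: algebra_simps)
    qed
  qed
  have "W - m \<notin> G"
  proof
    assume "W - m \<in> G"
    then obtain j s where j: "0 \<le> j" "j < m" "c j \<le> s" "W - m = j * d + s * m"
      using form by blast
    \<comment> \<open>The partner of index 0 has Apery element \<open>W\<close> itself, so
      \<open>W - m\<close> lies one step below the least admissible coefficient at
      \<open>k\<close>.\<close>
    obtain k where k: "0 \<le> k" "k < m" "k * d + c k * m = W"
      using sym[of 0] m c0 by auto
    then have eq: "k * d + (c k - 1) * m = j * d + s * m"
      using j(4) by (simp add: algebra_simps)
    then show False
      using coprime_representation_unique[OF cop k(1,2) j(1,2) eq] j(3) by simp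
  qed
  moreover have "W - m - x \<in> G" if "x \<notin> G" for x
  proof -
    obtain j s where j: "0 \<le> j" "j < m" "x = j * d + s * m"
      using coprime_representation[OF m cop] by blast
    then have s: "s < c j" using above[OF j(1,2)] that by (meson not_less)
    obtain k where k: "0 \<le> k" "k < m" "(j * d + c j * m) + (k * d + c k * m) = W"
      using sym j by blast
    \<comment> \<open>A gap has \<open>s \<le> c j - 1\<close>; subtracting the extra
      \<open>m\<close> compensates for this 1, so the coefficient is at least
      \<open>c k\<close>.\<close>
    have "W - m - x = k * d + (c k + (c j - 1 - s)) * m"
      unfolding k(3)[symmetric] j(3) by (simp add: algebra_simps)
    then show ?thesis using above[OF k(1,2)] s by simp
  qed
  ultimately show ?thesis
    using symmetric_numerical_semigroupI[of G "W - m"] semigroup_generated_nonneg[OF nonneg]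
    unfolding G_def by (auto intro: semigroup_generated.zero semigroup_generated.add)
qed

section \<open>The family \<open>gens_S\<close>\<close>

text \<open>Here \<open>c\<close> climbs to \<open>q + 1\<close>, stays there up to index
  \<open>q + e - 1\<close>, and climbs again to \<open>2 * q + 2\<close> at \<open>m - 1\<close>.
  This graph has a point symmetry, so \<open>j\<close> pairs with \<open>m - 1 - j\<close>, and
  \<open>W\<close> is the Apery element of index \<open>m - 1\<close>.\<close>

lemma gens_S_symmetric:
  fixes e q d :: int
  assumes e: "e \<ge> 4" and q: "q > 0" and d: "d > 0" and cop: "gcd (e + 2 * q + 1) d = 1"
  shows "numerical_semigroup (semigroup_generated (gens_S e q d)) \<and>
    symmetric_semigroup (semigroup_generated (gens_S e q d))"
proof -
  define m where "m = e + 2 * q + 1"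
  define c where "c j = min j (max (q + 1) (j + 2 - e))" for j
  have gens_eq: "gens_S e q d = {m, m + d} \<union> {(q + 1) * m + (q + i) * d | i. 2 \<le> i \<and> i \<le> e - 1}"
    by (simp add: gens_S_def m_def Let_def)
  \<comment> \<open>Splitting into the linear pieces reduces subadditivity and the pairing to linear
    arithmetic.\<close>
  have c_cases: "j \<le> q + 1 \<and> c j = j \<or> q + 1 < j \<and> j \<le> q + e - 1 \<and> c j = q + 1 \<or>
      q + e - 1 < j \<and> c j = j + 2 - e" for j
    using e by (auto simp: c_def)
  have step: "n * (m + d) \<in> semigroup_generated (gens_S e q d)" if "0 \<le> n" for n
    using that by (intro semigroup_generated_mult semigroup_generated.incl) (auto simp: gens_eq)
  have mid: "(q + 1) * m + j * d \<in> semigroup_generated (gens_S e q d)"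
    if "q + 2 \<le> j" "j \<le> q + e - 1" for j
    using that unfolding gens_eq
    by (intro semigroup_generated.incl UnI2 CollectI exI[of _ "j - q"]) auto
  show ?thesis
  proof (rule symmetric_of_apery[where m = m and d = d and c = c
        and W = "(2 * q + 2) * m + (m - 1) * d"])
    show "m > 0" "gcd m d = 1" "m \<in> gens_S e q d" "c 0 = 0"
      using e q cop by (auto simp: m_def c_def gens_eq)
    show "0 \<le> a" if "a \<in> gens_S e q d" for a
      using that e q d by (auto simp: gens_eq m_def)
    show "c (i + j) \<le> c i + c j" if "0 \<le> i" "i < m" "0 \<le> j" "j < m" "i + j < m" for i j
      using that e q c_cases[of i] c_cases[of j] c_cases[of "i + j"]
      unfolding m_def by (elim disjE conjE) linarith+
    show "c (i + j - m) \<le> c i + c j + d" if "0 \<le> i" "i < m" "0 \<le> j" "j < m" "m \<le> i + j" for i j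
      using that e q d c_cases[of i] c_cases[of j] c_cases[of "i + j - m"]
      unfolding m_def by (elim disjE conjE) linarith+
    show "\<exists>j s. 0 \<le> j \<and> j < m \<and> c j \<le> s \<and> a = j * d + s * m" if "a \<in> gens_S e q d" for a
    proof -
      consider "a = m" | "a = m + d"
        | i where "2 \<le> i" "i \<le> e - 1" "a = (q + 1) * m + (q + i) * d"
        using \<open>a \<in> gens_S e q d\<close> unfolding gens_eq by blast
      then show ?thesis
      proof cases
        case 1
        then show ?thesis using e q
          by (intro exI[of _ 0] exI[of _ 1]) (auto simp: c_def m_def)
      next
        case 2
        then show ?thesis using e q
          by (intro exI[of _ 1]) (auto simp: c_def m_def)
      next
        case 3
        then show ?thesis using e q
          by (intro exI[of _ "q + i"] exI[of _ "q + 1"]) (auto simp: c_def m_def)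
      qed
    qed
    show "j * d + c j * m \<in> semigroup_generated (gens_S e q d)" if j: "0 \<le> j" "j < m" for j
    proof -
      consider "j \<le> q + 1" | "q + 2 \<le> j" "j \<le> q + e - 1" | "q + e - 1 < j" by linarith
      then show ?thesis
      proof cases
        case 1
        then have "c j = j" by (simp add: c_def)
        then show ?thesis using step[OF j(1)] by (simp add: algebra_simps)
      next
        case 2
        then have "c j = q + 1" using e by (simp add: c_def)
        then show ?thesis using mid[OF 2] by (simp add: algebra_simps)
      next
        case 3
        then have cj: "c j = j + 2 - e" using e by (simp add: c_def)
        \<comment> \<open>The second climb starts from the last plateau generator and adds copies of
          \<open>m + d\<close>.\<close>
        have "j * d + c j * m
            = ((q + 1) * m + (q + e - 1) * d) + (j - (q + e - 1)) * (m + d)"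
          unfolding cj by (simp add: algebra_simps)
        then show ?thesis
          using semigroup_generated.add[OF mid[of "q + e - 1"] step[of "j - (q + e - 1)"]] 3 e
          by simp
      qed
    qed
    show "\<exists>k. 0 \<le> k \<and> k < m \<and> (j * d + c j * m) + (k * d + c k * m)
        = (2 * q + 2) * m + (m - 1) * d" if j: "0 \<le> j" "j < m" for j
    proof (intro exI[of _ "m - 1 - j"] conjI)
      have ck: "c (m - 1 - j) = 2 * q + 2 - c j"
        using j e q c_cases[of j] c_cases[of "m - 1 - j"]
        unfolding m_def by (elim disjE conjE) linarith+
      show "(j * d + c j * m) + ((m - 1 - j) * d + c (m - 1 - j) * m)
          = (2 * q + 2) * m + (m - 1) * d"
        unfolding ck by (simp add: algebra_simps)
    qed (use j in auto)
  qed
qed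

section \<open>The family \<open>gens_T\<close>\<close>

text \<open>As \<open>q + e / 2 = m / 2\<close>, the fractional terms combine to
  \<open>(1 - d) * m / 2 = - h * m\<close>, and \<open>j = 2 * q + 2 + k\<close> becomes the
  index.\<close>

lemma gens_T_eq:
  fixes e q h :: int
  defines "m \<equiv> e + 2 * q" and "d \<equiv> 2 * h + 1"
  shows "gens_T e q d
    = {m, m + d} \<union> {j * d + (q - h) * m | j. 2 * q + 2 \<le> j \<and> j < m}"
proof -
  have conv: "rat_of_int x = of_int (q * (m + 1)) + (of_int q - of_int (e - 4) / 2 + of_int k) * of_int d
      + of_int e / 2 \<longleftrightarrow> x = (2 * q + 2 + k) * d + (q - h) * m" for x k
  proof -
    have "of_int (q * (m + 1)) + (of_int q - of_int (e - 4) / 2 + of_int k) * of_int d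
      + of_int e / 2 = rat_of_int ((2 * q + 2 + k) * d + (q - h) * m)"
      by (simp add: m_def d_def field_simps)
    then show ?thesis by (simp only: of_int_eq_iff)
  qed
  have "{x. \<exists>k. 0 \<le> k \<and> k \<le> e - 3 \<and> x = (2 * q + 2 + k) * d + (q - h) * m}
      = {j * d + (q - h) * m | j. 2 * q + 2 \<le> j \<and> j < m}" (is "?L = ?R")
  proof
    show "?L \<subseteq> ?R" by (force simp: m_def)
    show "?R \<subseteq> ?L"
    proof clarify
      fix j assume "2 * q + 2 \<le> j" "j < m"
      then show "\<exists>k. 0 \<le> k \<and> k \<le> e - 3 \<and>
          j * d + (q - h) * m = (2 * q + 2 + k) * d + (q - h) * m"
        by (intro exI[of _ "j - (2 * q + 2)"]) (auto simp: m_def)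
    qed
  qed
  then show ?thesis
    unfolding gens_T_def Let_def m_def[symmetric] conv by simp
qed

text \<open>Multiples of \<open>m + d\<close> serve the indices up to \<open>2 * q + 1\<close>, and
  each later index has its own generator. Both ranges are reversed separately; the pair sums agree
  because \<open>2 * (q - h) + d = 2 * q + 1\<close>.\<close>

lemma gens_T_symmetric:
  fixes e q d :: int
  assumes e: "e \<ge> 4" and q: "q > 0" "q \<ge> e - 4" and d: "d > 0" "odd d"
    and cop: "gcd (e + 2 * q) d = 1"
  shows "numerical_semigroup (semigroup_generated (gens_T e q d)) \<and>
    symmetric_semigroup (semigroup_generated (gens_T e q d))"
proof -
  obtain h where h: "d = 2 * h + 1" using d(2) by (rule oddE)
  define m where "m = e + 2 * q"
  define c where "c j = (if j \<le> 2 * q + 1 then j else q - h)" for j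
  have gens_eq: "gens_T e q d
      = {m, m + d} \<union> {j * d + (q - h) * m | j. 2 * q + 2 \<le> j \<and> j < m}"
    unfolding h m_def by (rule gens_T_eq)
  have m_pos: "m > 0" using e q by (simp add: m_def)
  show ?thesis
  proof (rule symmetric_of_apery[where m = m and d = d and c = c
        and W = "(2 * q + 1) * (m + d)"])
    show "m > 0" "gcd m d = 1" "m \<in> gens_T e q d" "c 0 = 0"
      using m_pos q cop by (auto simp: m_def c_def gens_eq)
    show "0 \<le> a" if "a \<in> gens_T e q d" for a
    proof -
      have "0 \<le> j * d + (q - h) * m" if "2 * q + 2 \<le> j" for j
      proof -
        \<comment> \<open>Since \<open>q - h\<close> may be negative, the sign is not evident.
          Doubling replaces \<open>2 * h\<close> by \<open>d - 1\<close>, and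
          \<open>2 * j \<ge> m\<close> follows from \<open>e \<le> q + 4\<close>.\<close>
        have "2 * (j * d + (q - h) * m) = (2 * q + 1) * m + (2 * j - m) * d"
          by (simp add: h algebra_simps)
        also have "0 \<le> \<dots>"
          using that e q d m_pos by (intro add_nonneg_nonneg mult_nonneg_nonneg) (auto simp: m_def)
        finally show ?thesis by simp
      qed
      then show ?thesis using that d m_pos by (auto simp: gens_eq)
    qed
    \<comment> \<open>Two indices beyond \<open>2 * q + 1\<close> cannot occur here: their sum is at
      least \<open>4 * q + 4\<close>, which exceeds \<open>m\<close>.\<close>
    show "c (i + j) \<le> c i + c j" if "0 \<le> i" "i < m" "0 \<le> j" "j < m" "i + j < m" for i j
      using that e q d h unfolding c_def m_def by (simp split: if_splits)
    \<comment> \<open>The tight case has both indices beyond \<open>2 * q + 1\<close> and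
      \<open>i + j - m = 2 * q + 1\<close>, where both sides equal \<open>2 * q + 1\<close>.\<close>
    show "c (i + j - m) \<le> c i + c j + d" if "0 \<le> i" "i < m" "0 \<le> j" "j < m" "m \<le> i + j" for i j
      using that e q d h unfolding c_def m_def by (simp split: if_splits)
    show "\<exists>j s. 0 \<le> j \<and> j < m \<and> c j \<le> s \<and> a = j * d + s * m" if "a \<in> gens_T e q d" for a
    proof -
      consider "a = m" | "a = m + d"
        | j where "2 * q + 2 \<le> j" "j < m" "a = j * d + (q - h) * m"
        using \<open>a \<in> gens_T e q d\<close> unfolding gens_eq by blast
      then show ?thesis
      proof cases
        case 1
        then show ?thesis using e q
          by (intro exI[of _ 0] exI[of _ 1]) (auto simp: c_def m_def)
      next
        case 2
        then show ?thesis using e q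
          by (intro exI[of _ 1]) (auto simp: c_def m_def)
      next
        case 3
        then show ?thesis using q
          by (intro exI[of _ j] exI[of _ "q - h"]) (auto simp: c_def)
      qed
    qed
    show "j * d + c j * m \<in> semigroup_generated (gens_T e q d)" if j: "0 \<le> j" "j < m" for j
    proof (cases "j \<le> 2 * q + 1")
      case True
      have "j * (m + d) \<in> semigroup_generated (gens_T e q d)"
        using j(1) by (intro semigroup_generated_mult semigroup_generated.incl) (auto simp: gens_eq)
      then show ?thesis using True by (simp add: c_def algebra_simps)
    next
      case False
      then have "j * d + c j * m \<in> gens_T e q d"
        using j(2) unfolding gens_eq c_def by auto
      then show ?thesis by (rule semigroup_generated.incl)
    qed
    show "\<exists>k. 0 \<le> k \<and> k < m \<and> (j * d + c j * m) + (k * d + c k * m)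
        = (2 * q + 1) * (m + d)" if j: "0 \<le> j" "j < m" for j
    proof (cases "j \<le> 2 * q + 1")
      case True
      then show ?thesis
        using j e by (intro exI[of _ "2 * q + 1 - j"]) (auto simp: c_def m_def algebra_simps)
    next
      case False
      then show ?thesis
        \<comment> \<open>This witness reverses the range from \<open>2 * q + 2\<close> to
          \<open>m - 1\<close>; the surplus \<open>m * d\<close> in the sum supplies the missing
          \<open>d\<close> copies of \<open>m\<close>.\<close>
        using j e q by (intro exI[of _ "m + 2 * q + 1 - j"]) (auto simp: c_def h algebra_simps)
    qed
  qed
qed

theorem theorem4p3:
  shows "(\<forall>e q d :: int. e \<ge> 4 \<and> q > 0 \<and> d > 0 \<and> gcd (e + 2 * q + 1) d = 1 \<longrightarrow>
      numerical_semigroup (semigroup_generated (gens_S e q d)) \<and>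
      symmetric_semigroup (semigroup_generated (gens_S e q d))) \<and>
    (\<forall>e q d :: int. e \<ge> 4 \<and> q > 0 \<and> even q \<and> q \<ge> e - 4 \<and> d > 0 \<and> odd d \<and>
      gcd (e + 2 * q) d = 1 \<longrightarrow>
      numerical_semigroup (semigroup_generated (gens_T e q d)) \<and>
      symmetric_semigroup (semigroup_generated (gens_T e q d)))"
  by (simp add: gens_S_symmetric gens_T_symmetric)

end
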